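(* Let $U\subseteq\mathbb{R}^m$ be a nonempty closed convex set, let $F:U\to\mathbb{R}^m$ with $F(u)=\mathbb{E}[\Phi(u,\xi)]$ for all $u\in U$, and assume that the solution set $U^*$ of the variational inequality VI$(U,F)$ is nonempty and closed. Assume that: (i) for some $\sigma>0$ and all $k\ge 0$, $\mathbb{E}[\Phi(h_k,\xi_k)-F(h_k)\mid h_k]=0$ and $\mathbb{E}[\|\Phi(h_k,\xi_k)-F(h_k)\|^2\mid h_k]\le\sigma^2$; (ii) $F$ has linear growth on $U$: there exist $C\ge 0$, $D\ge 0$ such that $\|F(u)\|\le C\|u\|+D$ for all $u\in U$; (iii) $F$ is $2$-quasi sharp over $U$ relative to $U^*$: for some $\mu>0$, $\langle F(u),u-u^*\rangle\ge\mu\,\mathrm{dist}^2(u,U^* )$ for all $u\in U$ and all $u^*\in U^*$. Let the stepsizes be $\alpha_k=\frac{2}{\mu(3+k)}$ for all $k\ge 0$. Then the iterate sequence $\{u_k\}$ generated by the stochastic Popov method satisfies, for all $K\ge 2$, $$\mathbb{E}[\mathrm{dist}^2(u_{K+1},U^* )]\le\frac{18}{(K-1)^2}\,\mathbb{E}[\mathrm{dist}^2(u_1,U^* )]+\frac{24(4C^2M+\sigma^2+2D^2)}{\mu^2(K-1)},$$ where $C$ and $D$ are the constants from the linear growth condition (ii), and the scalar $M>0$ is such that $\mathbb{E}[\|h_k\|^2]\le M$ for all $k\ge 1$.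
   Context: The variational inequality VI$(U,F)$ is the problem of finding $u^*\in U$ with $\langle F(u^* ),u-u^*\rangle\ge 0$ for all $u\in U$; $U^*$ is the set of all such $u^*$. $\|\cdot\|$ is the Euclidean norm, $P_U(u)=\arg\min_{v\in U}\|v-u\|$ is the projection onto $U$, $\mathrm{dist}(u,Y)=\inf_{y\in Y}\|u-y\|$, and $\mathrm{dist}^2(u,Y)=(\mathrm{dist}(u,Y))^2$. Here $\Phi:U\times\mathbb{R}^d\to\mathbb{R}^m$ is a stochastic operator and $\xi$ is a $d$-dimensional random vector. Stochastic Popov method: given arbitrary deterministic points $u_0,h_0\in U$ and stepsizes $\alpha_k>0$, at each iteration $k\ge 0$, having $h_k$, a random sample $\xi_k$ is drawn according to the distribution of $\xi$, and $$u_{k+1}=P_U(u_k-\alpha_k\Phi(h_k,\xi_k)),\qquad h_{k+1}=P_U(u_{k+1}-\alpha_{k+1}\Phi(h_k,\xi_k)).$$ *)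

theory Defs
  imports "HOL-Probability.Probability"
begin

definition VI_solutions :: "(real^'m) set \<Rightarrow> (real^'m \<Rightarrow> real^'m) \<Rightarrow> (real^'m) set" where
  "VI_solutions U F = {x \<in> U. \<forall>u\<in>U. F x \<bullet> (u - x) \<ge> 0}"

definition linear_growth_on ::
    "(real^'m) set \<Rightarrow> (real^'m \<Rightarrow> real^'m) \<Rightarrow> real \<Rightarrow> real \<Rightarrow> bool" where
  "linear_growth_on U F C D \<longleftrightarrow> (\<forall>u\<in>U. norm (F u) \<le> C * norm u + D)"

definition two_quasi_sharp_on ::
    "(real^'m) set \<Rightarrow> (real^'m) set \<Rightarrow> (real^'m \<Rightarrow> real^'m) \<Rightarrow> real \<Rightarrow> bool" where
  "two_quasi_sharp_on U S F \<mu> \<longleftrightarrow>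
     (\<forall>u\<in>U. \<forall>x\<in>S. F u \<bullet> (u - x) \<ge> \<mu> * (infdist u S)\<^sup>2)"

definition stochastic_popov ::
    "'w set \<Rightarrow> (real^'m) set \<Rightarrow> (real^'m \<Rightarrow> real^'d \<Rightarrow> real^'m) \<Rightarrow> (nat \<Rightarrow> real) \<Rightarrow>
     (nat \<Rightarrow> 'w \<Rightarrow> real^'d) \<Rightarrow> real^'m \<Rightarrow> real^'m \<Rightarrow>
     (nat \<Rightarrow> 'w \<Rightarrow> real^'m) \<Rightarrow> (nat \<Rightarrow> 'w \<Rightarrow> real^'m) \<Rightarrow> bool" where
  "stochastic_popov \<Omega> U \<Phi> \<alpha> \<xi>s u\<^sub>0 h\<^sub>0 u h \<longleftrightarrow>
     (\<forall>\<omega>\<in>\<Omega>. u 0 \<omega> = u\<^sub>0 \<and> h 0 \<omega> = h\<^sub>0 \<and>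
       (\<forall>k. u (Suc k) \<omega> = closest_point U (u k \<omega> - \<alpha> k *\<^sub>R \<Phi> (h k \<omega>) (\<xi>s k \<omega>)) \<and>
            h (Suc k) \<omega> = closest_point U (u (Suc k) \<omega> - \<alpha> (Suc k) *\<^sub>R \<Phi> (h k \<omega>) (\<xi>s k \<omega>))))"

abbreviation sigma_of :: "'w measure \<Rightarrow> ('w \<Rightarrow> 'b::topological_space) \<Rightarrow> 'w measure" where
  "sigma_of P X \<equiv> vimage_algebra (space P) X borel"

text \<open>The library's conditional expectation is scalar, so that of a random vector is taken
  componentwise. As for \<^const>\<open>real_cond_exp\<close>, it is meaningful for integrable random vectors
  only.\<close>

definition vec_cond_exp ::
    "'w measure \<Rightarrow> 'w measure \<Rightarrow> ('w \<Rightarrow> real^'m) \<Rightarrow> 'w \<Rightarrow> real^'m" where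
  "vec_cond_exp P \<G> X \<omega> = (\<chi> i. real_cond_exp P \<G> (\<lambda>\<omega>. X \<omega> $ i) \<omega>)"

text \<open>The conditional second moment is taken in \<^typ>\<open>ennreal\<close>: the bound then forces the noise
  to be square integrable, hence integrable, so that the conditional mean in the first conjunct
  is the genuine one.\<close>

definition unbiased_bounded_noise ::
    "'w measure \<Rightarrow> ('w \<Rightarrow> real^'m) \<Rightarrow> ('w \<Rightarrow> real^'m) \<Rightarrow> real \<Rightarrow> bool" where
  "unbiased_bounded_noise P X e \<sigma> \<longleftrightarrow>
     (AE \<omega> in P. vec_cond_exp P (sigma_of P X) e \<omega> = 0) \<and>
     (AE \<omega> in P. nn_cond_exp P (sigma_of P X) (\<lambda>\<omega>. ennreal ((norm (e \<omega>))\<^sup>2)) \<omega> \<le> ennreal (\<sigma>\<^sup>2))"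

end

theory Submission
  imports Defs
begin

text \<open>Quasi-sharpness forces the closed solution set to be convex, so the nearest solution
  \<open>y\<^sub>k\<close> to \<open>u\<^sub>k\<close> is a continuous function of \<open>u\<^sub>k\<close>. The pair \<open>(u\<^sub>k, h\<^sub>k)\<close> depends on the samples
  before time \<open>k\<close> only; hence the noise at time \<open>k\<close> is orthogonal to \<open>h\<^sub>k - y\<^sub>k\<close>, and the two
  projection inequalities of a Popov step give, for \<open>k \<ge> 2\<close>,
  \<open>E d\<^sub>k\<^sub>+\<^sub>1 \<le> (1 - \<alpha>\<^sub>k \<mu>) E d\<^sub>k + 4 \<alpha>\<^sub>k\<^sup>2 (A + \<sigma>\<^sup>2)\<close> with \<open>d\<^sub>k\<close> the squared distance of \<open>u\<^sub>k\<close> to the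
  solutions and \<open>A = 2C\<^sup>2M + 2D\<^sup>2\<close>. As \<open>1 - \<alpha>\<^sub>k \<mu> = (k + 1) / (k + 3)\<close>, multiplying by
  \<open>(k + 2)(k + 3)\<close> telescopes. The step from \<open>u\<^sub>1\<close> to \<open>u\<^sub>2\<close> is special: the Popov estimate there
  involves \<open>h\<^sub>0\<close>, about which \<open>M\<close> says nothing, so that step is treated as a plain projected step,
  at the price of a factor \<open>3 / 2\<close>.\<close>

text \<open>The inequality defining quasi-sharpness is affine in the solution, so it persists on the
  convex hull; at a point \<open>z\<close> of the hull it says that \<open>z\<close> has distance \<open>0\<close> from the solutions.\<close>

lemma VI_solutions_convex:
  assumes "convex U" and "closed (VI_solutions U F)"
    and "\<mu> > 0" and sharp: "two_quasi_sharp_on U (VI_solutions U F) F \<mu>"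
  shows "convex (VI_solutions U F)"
proof (rule convexI)
  let ?S = "VI_solutions U F"
  fix x y and s t :: real
  assume S: "x \<in> ?S" "y \<in> ?S" and st: "0 \<le> s" "0 \<le> t" "s + t = 1"
  define z where "z = s *\<^sub>R x + t *\<^sub>R y"
  have "x \<in> U" "y \<in> U" using S by (auto simp: VI_solutions_def)
  then have "z \<in> U" using convexD[OF \<open>convex U\<close>] st unfolding z_def by blast
  then have ineq: "\<mu> * (infdist z ?S)\<^sup>2 \<le> F z \<bullet> (z - x)" "\<mu> * (infdist z ?S)\<^sup>2 \<le> F z \<bullet> (z - y)"
    using sharp S unfolding two_quasi_sharp_on_def by blast+
  have "\<mu> * (infdist z ?S)\<^sup>2 = s * (\<mu> * (infdist z ?S)\<^sup>2) + t * (\<mu> * (infdist z ?S)\<^sup>2)"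
    using st(3) by (metis distrib_right mult_1)
  also have "\<dots> \<le> s * (F z \<bullet> (z - x)) + t * (F z \<bullet> (z - y))"
    using ineq st by (intro add_mono mult_left_mono) auto
  also have "\<dots> = F z \<bullet> ((s + t) *\<^sub>R z - (s *\<^sub>R x + t *\<^sub>R y))"
    by (simp add: inner_simps algebra_simps)
  also have "\<dots> = 0" using st(3) by (simp add: z_def)
  finally have "(infdist z ?S)\<^sup>2 \<le> 0" using \<open>\<mu> > 0\<close> by (simp add: mult_le_0_iff)
  then have "infdist z ?S = 0" by simp
  then show "s *\<^sub>R x + t *\<^sub>R y \<in> ?S"
    using in_closed_iff_infdist_zero[OF assms(2)] S(1) unfolding z_def by blast
qed

subsection \<open>Projections onto closed convex sets\<close>

lemma infdist_closest_point:
  fixes S :: "'a::euclidean_space set"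
  assumes "closed S" "S \<noteq> {}"
  shows "infdist x S = norm (x - closest_point S x)"
  using setdist_closest_point[OF assms, of x] assms
  by (simp add: infdist_eq_setdist dist_norm)

lemma borel_measurable_closest_point:
  fixes S :: "'a::euclidean_space set"
  assumes "closed S" "convex S" "S \<noteq> {}"
  shows "closest_point S \<in> borel_measurable borel"
  using continuous_on_closest_point[of S UNIV] assms by (intro borel_measurable_continuous_onI) auto

text \<open>The angle at the projection between \<open>z\<close> and any point of \<open>U\<close>
  is obtuse, so Pythagoras holds as an inequality.\<close>

lemma projected_step:
  fixes y z :: "'a::euclidean_space"
  assumes "closed U" "convex U" "y \<in> U"
  shows "(norm (closest_point U z - y))\<^sup>2 \<le> (norm (z - y))\<^sup>2 - (norm (closest_point U z - z))\<^sup>2"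
  using closest_point_dot[OF assms(2,1,3), of z]
  by (simp add: power2_norm_eq_inner inner_simps inner_commute algebra_simps)

text \<open>Both projections start from the same \<open>u\<close>, with the fresh value
  \<open>g\<close> for \<open>u'\<close> and the stale value \<open>g'\<close> for \<open>h\<close>.
  The obtuse angle at \<open>u'\<close> is tested with \<open>y\<close> and the one at
  \<open>h\<close> with \<open>u'\<close>. What remains is the mismatch
  \<open>2 * a * ((g' - g) \<bullet> (u' - h))\<close>, to be paid for by the squared distance from
  \<open>u'\<close> to \<open>h\<close>.\<close>

lemma popov_step:
  fixes u g g' y :: "'a::euclidean_space"
  assumes "closed U" "convex U" "y \<in> U"
    and u': "u' = closest_point U (u - a *\<^sub>R g)"
    and h: "h = closest_point U (u - a *\<^sub>R g')"
  shows "(norm (u' - y))\<^sup>2 \<le> (norm (u - y))\<^sup>2 - 2 * a * (g \<bullet> (h - y))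
    + a\<^sup>2 * (norm (g - g'))\<^sup>2 - (norm (h - u))\<^sup>2"
proof -
  have "u' \<in> U" using assms closest_point_in_set by blast
  have "(norm (u' - y))\<^sup>2 \<le> (norm (u - a *\<^sub>R g - y))\<^sup>2 - (norm (u' - (u - a *\<^sub>R g)))\<^sup>2"
    using projected_step[OF assms(1-3)] u' by simp
  moreover have "(u - a *\<^sub>R g' - h) \<bullet> (u' - h) \<le> 0"
    using closest_point_dot[OF assms(2,1) \<open>u' \<in> U\<close>] h by simp
  \<comment> \<open>Completing the square bounds the mismatch minus the squared norm of
    \<open>u' - h\<close> by \<open>a\<^sup>2 * (norm (g - g'))\<^sup>2\<close>.\<close>
  moreover have "0 \<le> (norm (u' - h - a *\<^sub>R (g' - g)))\<^sup>2" by simp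
  ultimately show ?thesis
    unfolding power2_norm_eq_inner
    by (simp add: power2_eq_square inner_simps inner_commute algebra_simps)
qed

lemma norm_add_sq_le: "(norm (x + y))\<^sup>2 \<le> 2 * (norm x)\<^sup>2 + 2 * (norm y)\<^sup>2" for x y :: "'a::real_inner"
proof -
  have "0 \<le> (norm (x - y))\<^sup>2" by simp
  then show ?thesis by (simp add: power2_norm_eq_inner inner_simps inner_commute)
qed

lemma norm_diff_sq_le: "(norm (x - y))\<^sup>2 \<le> 2 * (norm x)\<^sup>2 + 2 * (norm y)\<^sup>2" for x y :: "'a::real_inner"
  using norm_add_sq_le[of x "- y"] by simp

subsection \<open>Square-integrable random vectors\<close>

definition sq_integrable :: "'w measure \<Rightarrow> ('w \<Rightarrow> 'a::euclidean_space) \<Rightarrow> bool" where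
  "sq_integrable M X \<longleftrightarrow> X \<in> borel_measurable M \<and> integrable M (\<lambda>\<omega>. (norm (X \<omega>))\<^sup>2)"

lemma sq_integrable_integrable: "sq_integrable M X \<Longrightarrow> integrable M (\<lambda>\<omega>. (norm (X \<omega>))\<^sup>2)"
  by (simp add: sq_integrable_def)

lemma sq_integrable_bound:
  assumes "X \<in> borel_measurable M" "integrable M f" "\<And>\<omega>. \<omega> \<in> space M \<Longrightarrow> (norm (X \<omega>))\<^sup>2 \<le> f \<omega>"
  shows "sq_integrable M X"
proof -
  have [measurable]: "X \<in> borel_measurable M" by fact
  have "integrable M (\<lambda>\<omega>. (norm (X \<omega>))\<^sup>2)"
    by (rule Bochner_Integration.integrable_bound[OF assms(2)]) (use assms(3) in \<open>fastforce intro!: AE_I2\<close>)+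
  with assms(1) show ?thesis by (simp add: sq_integrable_def)
qed

lemma sq_integrable_cong:
  "(\<And>\<omega>. \<omega> \<in> space M \<Longrightarrow> X \<omega> = Y \<omega>) \<Longrightarrow> sq_integrable M X \<longleftrightarrow> sq_integrable M Y"
  unfolding sq_integrable_def
  by (intro arg_cong2[of _ _ _ _ "(\<and>)"] measurable_cong Bochner_Integration.integrable_cong) auto

lemma sq_integrable_add:
  assumes "sq_integrable M X" "sq_integrable M Y"
  shows "sq_integrable M (\<lambda>\<omega>. X \<omega> + Y \<omega>)"
proof (rule sq_integrable_bound)
  show "integrable M (\<lambda>\<omega>. 2 * (norm (X \<omega>))\<^sup>2 + 2 * (norm (Y \<omega>))\<^sup>2)"
    using assms by (auto simp: sq_integrable_def)
qed (use assms in \<open>auto simp: sq_integrable_def intro: norm_add_sq_le\<close>)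

lemma sq_integrable_scaleR:
  assumes "sq_integrable M X"
  shows "sq_integrable M (\<lambda>\<omega>. c *\<^sub>R X \<omega>)"
  using assms by (auto simp: sq_integrable_def power_mult_distrib)

lemma sq_integrable_diff:
  assumes "sq_integrable M X" "sq_integrable M Y"
  shows "sq_integrable M (\<lambda>\<omega>. X \<omega> - Y \<omega>)"
  using sq_integrable_add[OF assms(1) sq_integrable_scaleR[OF assms(2), of "-1"]] by simp

lemma integrable_inner_sq_integrable:
  assumes "sq_integrable M X" "sq_integrable M Y"
  shows "integrable M (\<lambda>\<omega>. X \<omega> \<bullet> Y \<omega>)"
proof (rule Bochner_Integration.integrable_bound)
  show "integrable M (\<lambda>\<omega>. (norm (X \<omega>))\<^sup>2 + (norm (Y \<omega>))\<^sup>2)"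
    using assms by (auto simp: sq_integrable_def)
  show "(\<lambda>\<omega>. X \<omega> \<bullet> Y \<omega>) \<in> borel_measurable M"
    using assms by (auto simp: sq_integrable_def)
  have "\<bar>x \<bullet> y\<bar> \<le> (norm x)\<^sup>2 + (norm y)\<^sup>2" for x y :: 'b
    using Cauchy_Schwarz_ineq2[of x y] sum_squares_bound[of "norm x" "norm y"]
      mult_nonneg_nonneg[OF norm_ge_zero norm_ge_zero, of x y] by linarith
  then show "AE \<omega> in M. norm (X \<omega> \<bullet> Y \<omega>) \<le> norm ((norm (X \<omega>))\<^sup>2 + (norm (Y \<omega>))\<^sup>2)"
    by simp
qed

lemma (in prob_space) sq_integrable_const: "sq_integrable M (\<lambda>_. c)"
  by (simp add: sq_integrable_def)

text \<open>The projection is nonexpansive, hence grows at most linearly around the fixed point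
  value \<open>closest_point U 0\<close>, and constants are square integrable under a probability
  measure.\<close>

lemma (in prob_space) sq_integrable_closest_point:
  assumes "closed U" "convex U" "U \<noteq> {}" "sq_integrable M X"
  shows "sq_integrable M (\<lambda>\<omega>. closest_point U (X \<omega>))"
proof (rule sq_integrable_bound)
  show "(\<lambda>\<omega>. closest_point U (X \<omega>)) \<in> borel_measurable M"
    using borel_measurable_closest_point[OF assms(1-3)] assms(4)
    by (auto simp: sq_integrable_def intro: measurable_compose)
  show "integrable M (\<lambda>\<omega>. 2 * (norm (X \<omega>))\<^sup>2 + 2 * (norm (closest_point U 0))\<^sup>2)"
    using assms by (auto simp: sq_integrable_def)
  fix \<omega>
  have "norm (closest_point U (X \<omega>) - closest_point U 0) \<le> norm (X \<omega>)"
    using closest_point_lipschitz[OF assms(2,1,3), of "X \<omega>" 0] by (simp add: dist_norm)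
  then have "(norm (closest_point U (X \<omega>) - closest_point U 0))\<^sup>2 \<le> (norm (X \<omega>))\<^sup>2"
    by (rule power_mono) simp
  then show "(norm (closest_point U (X \<omega>)))\<^sup>2 \<le> 2 * (norm (X \<omega>))\<^sup>2 + 2 * (norm (closest_point U 0))\<^sup>2"
    using norm_add_sq_le[of "closest_point U (X \<omega>) - closest_point U 0" "closest_point U 0"]
    unfolding diff_add_cancel by linarith
qed

text \<open>Independence makes the joint law of \<open>W\<close> and \<open>X\<close> a product
  measure; Fubini then integrates \<open>X\<close> out with \<open>W\<close> frozen.\<close>

lemma (in prob_space) indep_var_expectation:
  fixes g :: "_ \<Rightarrow> real"
  assumes indep: "indep_var S W T X" and [measurable]: "g \<in> borel_measurable (S \<Otimes>\<^sub>M T)"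
    and int: "integrable M (\<lambda>\<omega>. g (W \<omega>, X \<omega>))"
  shows "expectation (\<lambda>\<omega>. g (W \<omega>, X \<omega>)) = expectation (\<lambda>\<omega>. \<integral>x. g (W \<omega>, x) \<partial>distr M T X)"
proof -
  have [measurable]: "W \<in> M \<rightarrow>\<^sub>M S" "X \<in> M \<rightarrow>\<^sub>M T"
    and eq: "distr M S W \<Otimes>\<^sub>M distr M T X = distr M (S \<Otimes>\<^sub>M T) (\<lambda>\<omega>. (W \<omega>, X \<omega>))"
    using indep unfolding indep_var_distribution_eq by auto
  interpret W: prob_space "distr M S W" by (rule prob_space_distr) simp
  interpret X: prob_space "distr M T X" by (rule prob_space_distr) simp
  interpret pair_sigma_finite "distr M S W" "distr M T X" ..
  have "integrable (distr M S W \<Otimes>\<^sub>M distr M T X) g"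
    unfolding eq using int by (simp add: integrable_distr_eq)
  then have "(\<integral>w. (\<integral>x. g (w, x) \<partial>distr M T X) \<partial>distr M S W) = integral\<^sup>L (distr M S W \<Otimes>\<^sub>M distr M T X) g"
    by (rule integral_fst')
  also have "\<dots> = expectation (\<lambda>\<omega>. g (W \<omega>, X \<omega>))"
    unfolding eq by (simp add: integral_distr)
  also have "(\<integral>w. (\<integral>x. g (w, x) \<partial>distr M T X) \<partial>distr M S W) = expectation (\<lambda>\<omega>. \<integral>x. g (W \<omega>, x) \<partial>distr M T X)"
    by (rule integral_distr) measurable
  finally show ?thesis by simp
qed

text \<open>The tower property is applied in \<open>ennreal\<close>, where it needs no integrability
  beforehand. The finite bound then yields integrability, which justifies returning to the
  real-valued expectation.\<close>

lemma (in prob_space) unbiased_bounded_noise_second_moment: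
  assumes [measurable]: "X \<in> borel_measurable M" "e \<in> borel_measurable M"
    and "unbiased_bounded_noise M X e \<sigma>"
  shows "sq_integrable M e" and "expectation (\<lambda>\<omega>. (norm (e \<omega>))\<^sup>2) \<le> \<sigma>\<^sup>2"
proof -
  have sub: "subalgebra M (sigma_of M X)"
    unfolding subalgebra_def by (simp add: sets_vimage_algebra2) (auto intro!: measurable_sets)
  interpret finite_measure_subalgebra M "sigma_of M X" by standard (rule sub)
  let ?f = "\<lambda>\<omega>. ennreal ((norm (e \<omega>))\<^sup>2)"
  have "(\<integral>\<^sup>+ \<omega>. ?f \<omega> \<partial>M) = (\<integral>\<^sup>+ \<omega>. nn_cond_exp M (sigma_of M X) ?f \<omega> \<partial>M)"
    using nn_cond_exp_intg[of "\<lambda>_. 1" ?f] by simp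
  also have "\<dots> \<le> (\<integral>\<^sup>+ \<omega>. ennreal (\<sigma>\<^sup>2) \<partial>M)"
    using assms(3) unfolding unbiased_bounded_noise_def by (intro nn_integral_mono_AE) auto
  finally have le: "(\<integral>\<^sup>+ \<omega>. ?f \<omega> \<partial>M) \<le> ennreal (\<sigma>\<^sup>2)"
    by (simp add: emeasure_space_1)
  then show sq: "sq_integrable M e"
    unfolding sq_integrable_def using order_le_less_trans[OF le ennreal_less_top]
    by (auto intro: integrableI_bounded)
  show "expectation (\<lambda>\<omega>. (norm (e \<omega>))\<^sup>2) \<le> \<sigma>\<^sup>2"
    using le sq by (simp add: sq_integrable_def nn_integral_eq_integral)
qed

subsection \<open>Dependence of the iterates on the samples\<close>

text \<open>\<open>\<Phi>\<close> is known to be measurable only for first arguments in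
  \<open>U\<close>. Precomposing with the projection gives a function measurable on the whole space
  that agrees with \<open>\<Phi>\<close> on \<open>U\<close>.\<close>

lemma measurable_comp_closest_point:
  fixes U :: "(real^'m) set" and \<Phi> :: "real^'m \<Rightarrow> real^'d \<Rightarrow> real^'m"
  assumes "closed U" "convex U" "U \<noteq> {}"
    and \<Phi>: "case_prod \<Phi> \<in> borel_measurable (restrict_space borel U \<Otimes>\<^sub>M borel)"
  shows "(\<lambda>(v, x). \<Phi> (closest_point U v) x) \<in> borel_measurable (borel \<Otimes>\<^sub>M borel)"
proof -
  have [measurable]: "closest_point U \<in> borel \<rightarrow>\<^sub>M restrict_space borel U"
    using borel_measurable_closest_point[OF assms(1-3)] closest_point_in_set[OF assms(1,3)]
    by (intro measurable_restrict_space2) auto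
  have "(\<lambda>(v, x). (closest_point U v, x)) \<in> borel \<Otimes>\<^sub>M borel \<rightarrow>\<^sub>M restrict_space borel U \<Otimes>\<^sub>M borel"
    by measurable
  from measurable_compose[OF this \<Phi>] show ?thesis by (simp add: case_prod_beta')
qed

lemma stochastic_popov_in_set:
  assumes "closed U" "u\<^sub>0 \<in> U" "h\<^sub>0 \<in> U"
    and sp: "stochastic_popov \<Omega> U \<Phi> \<alpha> \<xi>s u\<^sub>0 h\<^sub>0 u h" and "\<omega> \<in> \<Omega>"
  shows "u k \<omega> \<in> U" "h k \<omega> \<in> U"
proof -
  have "u k \<omega> \<in> U \<and> h k \<omega> \<in> U"
  proof (cases k)
    case 0
    then show ?thesis using assms by (simp add: stochastic_popov_def)
  next
    case (Suc j)
    have "U \<noteq> {}" using assms(2) by blast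
    with Suc show ?thesis
      using sp \<open>\<omega> \<in> \<Omega>\<close> closest_point_in_set[OF \<open>closed U\<close>] by (simp add: stochastic_popov_def)
  qed
  then show "u k \<omega> \<in> U" "h k \<omega> \<in> U" by auto
qed

text \<open>This expresses that the iterates are determined by the past: samples with index at least
  \<open>k\<close> do not enter, so the pair at time \<open>k\<close> will be independent of
  \<open>\<xi>s k\<close>.\<close>

lemma stochastic_popov_factor:
  fixes U :: "(real^'m) set" and \<Phi> :: "real^'m \<Rightarrow> real^'d \<Rightarrow> real^'m"
  assumes U: "closed U" "convex U" and "u\<^sub>0 \<in> U" "h\<^sub>0 \<in> U"
    and \<Phi>: "case_prod \<Phi> \<in> borel_measurable (restrict_space borel U \<Otimes>\<^sub>M borel)"
    and sp: "stochastic_popov \<Omega> U \<Phi> \<alpha> \<xi>s u\<^sub>0 h\<^sub>0 u h"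
  shows "\<exists>f. f \<in> PiM {..<k} (\<lambda>_. borel) \<rightarrow>\<^sub>M borel \<Otimes>\<^sub>M borel \<and>
    (\<forall>\<omega>\<in>\<Omega>. (u k \<omega>, h k \<omega>) = f (\<lambda>i\<in>{..<k}. \<xi>s i \<omega>))"
proof (induction k)
  case 0
  show ?case
    using sp by (intro exI[of _ "\<lambda>_. (u\<^sub>0, h\<^sub>0)"]) (auto simp: stochastic_popov_def)
next
  case (Suc k)
  then obtain f where [measurable]: "f \<in> PiM {..<k} (\<lambda>_. borel) \<rightarrow>\<^sub>M borel \<Otimes>\<^sub>M borel"
    and f: "\<And>\<omega>. \<omega> \<in> \<Omega> \<Longrightarrow> (u k \<omega>, h k \<omega>) = f (\<lambda>i\<in>{..<k}. \<xi>s i \<omega>)" by blast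
  have ne: "U \<noteq> {}" using \<open>h\<^sub>0 \<in> U\<close> by blast
  let ?N = "PiM {..<Suc k} (\<lambda>_. borel :: (real^'d) measure)"
  define p where "p = (\<lambda>x :: nat \<Rightarrow> real^'d. f (restrict x {..<k}))"
  \<comment> \<open>The projection secures measurability on all sample tuples; at the actual iterate
    it is the identity because \<open>h k \<omega>\<close> lies in \<open>U\<close>.\<close>
  define g where "g = (\<lambda>x :: nat \<Rightarrow> real^'d. \<Phi> (closest_point U (snd (p x))) (x k))"
  define u' where "u' = (\<lambda>x. closest_point U (fst (p x) - \<alpha> k *\<^sub>R g x))"
  define h' where "h' = (\<lambda>x. closest_point U (u' x - \<alpha> (Suc k) *\<^sub>R g x))"
  have [measurable]: "closest_point U \<in> borel_measurable borel"
    using U ne by (rule borel_measurable_closest_point)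
  have "(\<lambda>x. restrict x {..<k}) \<in> ?N \<rightarrow>\<^sub>M PiM {..<k} (\<lambda>_. borel)"
    by (rule measurable_restrict_subset) auto
  then have p[measurable]: "p \<in> ?N \<rightarrow>\<^sub>M borel \<Otimes>\<^sub>M borel"
    unfolding p_def by measurable
  have [measurable]: "(\<lambda>x. x k) \<in> ?N \<rightarrow>\<^sub>M borel"
    by (rule measurable_component_singleton) simp
  have "(\<lambda>x. (snd (p x), x k)) \<in> ?N \<rightarrow>\<^sub>M borel \<Otimes>\<^sub>M borel" by measurable
  from measurable_compose[OF this measurable_comp_closest_point[OF U ne \<Phi>]]
  have [measurable]: "g \<in> ?N \<rightarrow>\<^sub>M borel" by (simp add: g_def)
  have [measurable]: "u' \<in> ?N \<rightarrow>\<^sub>M borel" unfolding u'_def by measurable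
  have [measurable]: "h' \<in> ?N \<rightarrow>\<^sub>M borel" unfolding h'_def by measurable
  show ?case
  proof (intro exI conjI ballI)
    show "(\<lambda>x. (u' x, h' x)) \<in> ?N \<rightarrow>\<^sub>M borel \<Otimes>\<^sub>M borel" by measurable
    fix \<omega> assume "\<omega> \<in> \<Omega>"
    let ?x = "\<lambda>i\<in>{..<Suc k}. \<xi>s i \<omega>"
    have "restrict ?x {..<k} = (\<lambda>i\<in>{..<k}. \<xi>s i \<omega>)" by (auto simp: restrict_def fun_eq_iff)
    with f[OF \<open>\<omega> \<in> \<Omega>\<close>] have "p ?x = (u k \<omega>, h k \<omega>)" by (simp add: p_def)
    moreover have "h k \<omega> \<in> U"
      using stochastic_popov_in_set[OF U(1) assms(3,4) sp \<open>\<omega> \<in> \<Omega>\<close>] by blast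
    ultimately show "(u (Suc k) \<omega>, h (Suc k) \<omega>) = (u' ?x, h' ?x)"
      using sp \<open>\<omega> \<in> \<Omega>\<close>
      by (simp add: stochastic_popov_def h'_def u'_def g_def closest_point_self)
  qed
qed

subsection \<open>Solving the recursion\<close>

text \<open>Multiplied by \<open>(k + 3) * (k + 2)\<close>, the recursion lets the sequence
  \<open>(k + 2) * (k + 1) * d k\<close> grow by at most a constant per step. Summing and dividing
  by the last weight leaves a term of order \<open>1 / K^2\<close> and one of order
  \<open>1 / K\<close>.\<close>

lemma popov_recursion_bound:
  fixes d \<alpha> :: "nat \<Rightarrow> real"
  assumes \<mu>: "\<mu> > 0" and \<alpha>: "\<And>k. \<alpha> k = 2 / (\<mu> * (3 + real k))"
    and d1: "0 \<le> d 1" and A: "0 \<le> A" and s: "0 \<le> s"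
    and first: "d 2 \<le> 3 / 2 * d 1 + (\<alpha> 1)\<^sup>2 * (3 * A + s)"
    and step: "\<And>k. k \<ge> 2 \<Longrightarrow> d (Suc k) \<le> (1 - \<alpha> k * \<mu>) * d k + (\<alpha> k)\<^sup>2 * (4 * A + 4 * s)"
    and K: "K \<ge> 2"
  shows "d (Suc K) \<le> 18 / (real K - 1)\<^sup>2 * d 1 + 24 * (A + s) / (\<mu>\<^sup>2 * (real K - 1))"
proof -
  \<comment> \<open>The factor 16 is 4 from the squared stepsize times 4 from the noise term of
    \<open>step\<close>.\<close>
  define B where "B = 16 * (A + s) / \<mu>\<^sup>2"
  have B: "0 \<le> B" using A s by (simp add: B_def)
  have step': "(real k + 3) * (real k + 2) * d (Suc k) \<le> (real k + 2) * (real k + 1) * d k + B"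
    if "k \<ge> 2" for k
  proof -
    have \<alpha>\<mu>: "\<alpha> k * \<mu> = 2 / (real k + 3)" using \<mu> by (simp add: \<alpha> add.commute)
    have \<alpha>B: "(\<alpha> k)\<^sup>2 * (4 * A + 4 * s) = B / (real k + 3)\<^sup>2"
      using \<mu> by (simp add: \<alpha> B_def power_divide power_mult_distrib add.commute)
    have "d (Suc k) \<le> (1 - 2 / (real k + 3)) * d k + B / (real k + 3)\<^sup>2"
      using step[OF that] unfolding \<alpha>\<mu> \<alpha>B by simp
    then have "(real k + 3) * (real k + 2) * d (Suc k)
        \<le> (real k + 3) * (real k + 2) * ((1 - 2 / (real k + 3)) * d k + B / (real k + 3)\<^sup>2)"
      by (intro mult_left_mono) auto
    also have "\<dots> = (real k + 2) * (real k + 1) * d k + B * ((real k + 2) / (real k + 3))"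
      by (simp add: divide_simps power2_eq_square) (simp add: algebra_simps)
    also have "B * ((real k + 2) / (real k + 3)) \<le> B" using B by (intro mult_left_le) auto
    finally show ?thesis by (simp add: algebra_simps)
  qed
  \<comment> \<open>The sum starts at \<open>d 2\<close>, whose weight is
    \<open>12 = (2 + 2) * (2 + 1)\<close>. For \<open>n = 1\<close> the claim is an
    equality.\<close>
  have "(real n + 3) * (real n + 2) * d (Suc n) \<le> 12 * d 2 + B * (real n - 1)" if "n \<ge> 1" for n
    using that
  proof (induction n rule: nat_induct_at_least)
    case base
    show ?case by (simp add: numeral_2_eq_2)
  next
    case (Suc n)
    have "(real (Suc n) + 3) * (real (Suc n) + 2) * d (Suc (Suc n))
        \<le> (real n + 3) * (real n + 2) * d (Suc n) + B"
      using step'[of "Suc n"] Suc.hyps by (simp add: algebra_simps)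
    with Suc.IH show ?case by (simp add: algebra_simps)
  qed
  from this[of K] K
  have le: "(real K + 3) * (real K + 2) * d (Suc K) \<le> 12 * d 2 + B * (real K - 1)" by simp
  define n where "n = real K - 1"
  have n_eq: "real K + 3 = n + 4" "real K + 2 = n + 3" "real K - 1 = n" by (simp_all add: n_def)
  have n: "n \<ge> 1" using K by (simp add: n_def)
  \<comment> \<open>Here \<open>\<alpha> 1 = 1 / (2 * \<mu>)\<close>. Multiplying
    \<open>first\<close> by 12 turns \<open>3 / 2\<close> into the 18 of the final bound and
    \<open>1 / 4\<close> into 3.\<close>
  have "(\<alpha> 1)\<^sup>2 * (3 * A + s) = 1 / 4 * ((3 * A + s) / \<mu>\<^sup>2)"
    by (simp add: \<alpha> power_divide power_mult_distrib)
  with first have "12 * d 2 \<le> 18 * d 1 + 3 * ((3 * A + s) / \<mu>\<^sup>2)" by linarith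
  then have "12 * d 2 \<le> 18 * d 1 + 3 * (3 * A + s) / \<mu>\<^sup>2" by simp
  then have "(n + 4) * (n + 3) * d (Suc K) \<le> 18 * d 1 + 3 * (3 * A + s) / \<mu>\<^sup>2 + B * n"
    using le unfolding n_eq by linarith
  also have "\<dots> = 18 * d 1 + (9 * A + 3 * s + 16 * (A + s) * n) / \<mu>\<^sup>2"
    by (simp add: B_def add_divide_distrib algebra_simps)
  finally have main: "(n + 4) * (n + 3) * d (Suc K) \<le> \<dots>" .
  have sq: "n\<^sup>2 \<le> (n + 4) * (n + 3)" "0 < (n + 4) * (n + 3)"
  proof -
    show "n\<^sup>2 \<le> (n + 4) * (n + 3)" using n by (simp add: power2_eq_square algebra_simps)
    show "0 < (n + 4) * (n + 3)" using n by (intro mult_pos_pos) auto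
  qed
  have "d (Suc K) \<le> (18 * d 1 + (9 * A + 3 * s + 16 * (A + s) * n) / \<mu>\<^sup>2) / ((n + 4) * (n + 3))"
    using main sq(2) by (simp add: pos_le_divide_eq mult.commute)
  \<comment> \<open>The numerator is linear in \<open>n\<close> and
    \<open>(n + 4) * (n + 3) / n\<close> is at least \<open>n + 7\<close>. Since 16 is below 24 and
    both 9 and 3 are below \<open>24 * 7\<close>, the constant 24 covers it, and the product then
    cancels against the denominator.\<close>
  also have "\<dots> \<le> (18 * d 1 + (24 * A + 24 * s) * ((n + 4) * (n + 3) / n) / \<mu>\<^sup>2) / ((n + 4) * (n + 3))"
  proof (intro divide_right_mono add_left_mono)
    have "n + 7 \<le> (n + 4) * (n + 3) / n" using n by (simp add: field_simps)
    then have "(24 * A + 24 * s) * (n + 7) \<le> (24 * A + 24 * s) * ((n + 4) * (n + 3) / n)"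
      using A s by (intro mult_left_mono) auto
    moreover have "9 * A + 3 * s + 16 * (A + s) * n \<le> (24 * A + 24 * s) * (n + 7)"
      using A s n mult_nonneg_nonneg[of A n] mult_nonneg_nonneg[of s n] by (simp add: algebra_simps)
    ultimately show "9 * A + 3 * s + 16 * (A + s) * n \<le> (24 * A + 24 * s) * ((n + 4) * (n + 3) / n)"
      by linarith
  qed (use n in auto)
  also have "\<dots> = 18 * d 1 / ((n + 4) * (n + 3)) + 24 * (A + s) / (\<mu>\<^sup>2 * n)"
  proof -
    have "(24 * A + 24 * s) * (q / n) / \<mu>\<^sup>2 / q = 24 * (A + s) / (\<mu>\<^sup>2 * n)" if "0 < q" for q
      using n \<mu> that by (simp add: divide_simps)
    from this[OF sq(2)] show ?thesis by (simp only: add_divide_distrib)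
  qed
  also have "18 * d 1 / ((n + 4) * (n + 3)) \<le> 18 * d 1 / n\<^sup>2"
    using sq n d1 by (intro divide_left_mono) auto
  finally show ?thesis by (simp add: n_def)
qed

subsection \<open>One step in expectation\<close>

text \<open>The stepsizes stay arbitrary here. What is required of them, and the moment bound
  \<open>M\<close>, are assumptions of the individual lemmas, and the formula for
  \<open>\<alpha>\<close> enters only in the theorem.\<close>

locale popov_vi = prob_space P
  for P :: "'w measure" +
  fixes U :: "(real^'m) set"
    and F :: "real^'m \<Rightarrow> real^'m"
    and \<Phi> :: "real^'m \<Rightarrow> real^'d \<Rightarrow> real^'m"
    and \<xi> :: "'w \<Rightarrow> real^'d"
    and \<xi>s :: "nat \<Rightarrow> 'w \<Rightarrow> real^'d"
    and u\<^sub>0 h\<^sub>0 :: "real^'m"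
    and u h :: "nat \<Rightarrow> 'w \<Rightarrow> real^'m"
    and \<alpha> :: "nat \<Rightarrow> real"
    and \<sigma> C D \<mu> :: real
  assumes U: "closed U" "convex U"
    and \<Phi>_meas: "case_prod \<Phi> \<in> borel_measurable (restrict_space borel U \<Otimes>\<^sub>M borel)"
    and \<xi>_meas: "\<xi> \<in> borel_measurable P"
    and \<Phi>_int: "\<And>v. v \<in> U \<Longrightarrow> integrable P (\<lambda>\<omega>. \<Phi> v (\<xi> \<omega>))"
    and F_eq: "\<And>v. v \<in> U \<Longrightarrow> F v = (\<integral>\<omega>. \<Phi> v (\<xi> \<omega>) \<partial>P)"
    and S: "VI_solutions U F \<noteq> {}" "closed (VI_solutions U F)"
    and indep: "indep_vars (\<lambda>_. borel) \<xi>s UNIV"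
    and distr: "\<And>k. distr P borel (\<xi>s k) = distr P borel \<xi>"
    and init: "u\<^sub>0 \<in> U" "h\<^sub>0 \<in> U"
    and popov: "stochastic_popov (space P) U \<Phi> \<alpha> \<xi>s u\<^sub>0 h\<^sub>0 u h"
    and noise: "\<And>k. unbiased_bounded_noise P (h k) (\<lambda>\<omega>. \<Phi> (h k \<omega>) (\<xi>s k \<omega>) - F (h k \<omega>)) \<sigma>"
    and growth: "linear_growth_on U F C D"
    and \<mu>: "\<mu> > 0" and sharp: "two_quasi_sharp_on U (VI_solutions U F) F \<mu>"
begin

definition G :: "nat \<Rightarrow> 'w \<Rightarrow> real^'m" where
  "G k \<omega> = \<Phi> (h k \<omega>) (\<xi>s k \<omega>)"

definition noise_vec :: "nat \<Rightarrow> 'w \<Rightarrow> real^'m" where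
  "noise_vec k \<omega> = G k \<omega> - F (h k \<omega>)"

text \<open>This random solution serves as the comparison point at step \<open>k\<close>. It depends
  on \<open>u k\<close> alone, so it is determined by the past and the noise averages out against
  it.\<close>

definition sol_proj :: "nat \<Rightarrow> 'w \<Rightarrow> real^'m" where
  "sol_proj k \<omega> = closest_point (VI_solutions U F) (u k \<omega>)"

definition sq_dist :: "nat \<Rightarrow> 'w \<Rightarrow> real" where
  "sq_dist k \<omega> = (infdist (u k \<omega>) (VI_solutions U F))\<^sup>2"

lemma U_nonempty: "U \<noteq> {}"
  using init by blast

lemma S_convex: "convex (VI_solutions U F)"
  using VI_solutions_convex[OF U(2) S(2) \<mu> sharp] .

lemma iter_in_U: "\<omega> \<in> space P \<Longrightarrow> u k \<omega> \<in> U" "\<omega> \<in> space P \<Longrightarrow> h k \<omega> \<in> U"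
  using stochastic_popov_in_set[OF U(1) init popov] by auto

lemma sol_proj_in: "sol_proj k \<omega> \<in> VI_solutions U F"
  unfolding sol_proj_def using closest_point_in_set S by blast

lemma sq_dist_eq: "sq_dist k \<omega> = (norm (u k \<omega> - sol_proj k \<omega>))\<^sup>2"
  unfolding sq_dist_def sol_proj_def using infdist_closest_point[OF S(2,1)] by simp

lemma sq_dist_le: "x \<in> VI_solutions U F \<Longrightarrow> sq_dist k \<omega> \<le> (norm (u k \<omega> - x))\<^sup>2"
  unfolding sq_dist_def by (intro power_mono) (auto simp: infdist_nonneg infdist_le simp flip: dist_norm)

section \<open>Measurability of the iterates and of the operator along them\<close>

lemma \<xi>s_meas[measurable]: "\<xi>s k \<in> borel_measurable P"
  using indep by (auto simp: indep_vars_def)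

lemma iter_factor:
  obtains f where "f \<in> PiM {..<k} (\<lambda>_. borel) \<rightarrow>\<^sub>M borel \<Otimes>\<^sub>M borel"
    and "\<And>\<omega>. \<omega> \<in> space P \<Longrightarrow> (u k \<omega>, h k \<omega>) = f (\<lambda>i\<in>{..<k}. \<xi>s i \<omega>)"
  using stochastic_popov_factor[OF U init \<Phi>_meas popov, of k] by blast

lemma iter_meas: "(\<lambda>\<omega>. (u k \<omega>, h k \<omega>)) \<in> P \<rightarrow>\<^sub>M borel \<Otimes>\<^sub>M borel"
proof -
  obtain f where [measurable]: "f \<in> PiM {..<k} (\<lambda>_. borel) \<rightarrow>\<^sub>M borel \<Otimes>\<^sub>M borel"
    and f: "\<And>\<omega>. \<omega> \<in> space P \<Longrightarrow> (u k \<omega>, h k \<omega>) = f (\<lambda>i\<in>{..<k}. \<xi>s i \<omega>)"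
    using iter_factor[of k] by blast
  have "(\<lambda>\<omega>. f (\<lambda>i\<in>{..<k}. \<xi>s i \<omega>)) \<in> P \<rightarrow>\<^sub>M borel \<Otimes>\<^sub>M borel" by measurable
  then show ?thesis by (subst measurable_cong[OF f])
qed

lemma u_meas[measurable]: "u k \<in> borel_measurable P"
  and h_meas[measurable]: "h k \<in> borel_measurable P"
  using measurable_compose[OF iter_meas measurable_fst, of k]
    measurable_compose[OF iter_meas measurable_snd, of k] by simp_all

lemma proj_U_meas[measurable]: "closest_point U \<in> borel_measurable borel"
  using borel_measurable_closest_point[OF U U_nonempty] .

lemma \<Phi>_proj_meas[measurable]:
  "(\<lambda>(v, x). \<Phi> (closest_point U v) x) \<in> borel_measurable (borel \<Otimes>\<^sub>M borel)"
  using measurable_comp_closest_point[OF U U_nonempty \<Phi>_meas] .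

text \<open>\<open>F\<close> is the integral of the jointly measurable \<open>\<Phi>\<close> over
  the sample, and parameter integrals are measurable. The projection keeps the argument in
  \<open>U\<close>, where this formula for \<open>F\<close> is valid.\<close>

lemma F_proj_meas[measurable]: "(\<lambda>v. F (closest_point U v)) \<in> borel_measurable borel"
proof -
  have [measurable]: "\<xi> \<in> borel_measurable P" by (rule \<xi>_meas)
  have "(\<lambda>(v, \<omega>). (v, \<xi> \<omega>)) \<in> borel \<Otimes>\<^sub>M P \<rightarrow>\<^sub>M borel \<Otimes>\<^sub>M borel" by measurable
  from measurable_compose[OF this \<Phi>_proj_meas]
  have "(\<lambda>(v, \<omega>). \<Phi> (closest_point U v) (\<xi> \<omega>)) \<in> borel_measurable (borel \<Otimes>\<^sub>M P)"
    by (simp add: case_prod_beta')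
  then have "(\<lambda>v. \<integral>\<omega>. \<Phi> (closest_point U v) (\<xi> \<omega>) \<partial>P) \<in> borel_measurable borel"
    by (rule borel_measurable_lebesgue_integral)
  then show ?thesis
    using F_eq[OF closest_point_in_set[OF U(1) U_nonempty]] by simp
qed

lemma F_meas[measurable]: "(\<lambda>\<omega>. F (h k \<omega>)) \<in> borel_measurable P"
proof -
  have "(\<lambda>\<omega>. F (closest_point U (h k \<omega>))) \<in> borel_measurable P" by measurable
  then show ?thesis
    by (rule measurable_cong[THEN iffD1, rotated]) (simp add: closest_point_self iter_in_U)
qed

lemma G_meas[measurable]: "G k \<in> borel_measurable P"
proof -
  have "(\<lambda>\<omega>. (h k \<omega>, \<xi>s k \<omega>)) \<in> P \<rightarrow>\<^sub>M borel \<Otimes>\<^sub>M borel" by measurable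
  from measurable_compose[OF this \<Phi>_proj_meas] show ?thesis
    by (rule measurable_cong[THEN iffD1, rotated]) (simp add: G_def closest_point_self iter_in_U)
qed

lemma noise_vec_meas[measurable]: "noise_vec k \<in> borel_measurable P"
  unfolding noise_vec_def by measurable

section \<open>Square integrability along the iteration and orthogonality of the noise\<close>

lemma noise_vec_sq_integrable: "sq_integrable P (noise_vec k)"
  and noise_vec_second_moment: "expectation (\<lambda>\<omega>. (norm (noise_vec k \<omega>))\<^sup>2) \<le> \<sigma>\<^sup>2"
proof -
  have "unbiased_bounded_noise P (h k) (noise_vec k) \<sigma>"
    using noise[of k] unfolding noise_vec_def G_def .
  from unbiased_bounded_noise_second_moment[OF h_meas noise_vec_meas this]
  show "sq_integrable P (noise_vec k)" "expectation (\<lambda>\<omega>. (norm (noise_vec k \<omega>))\<^sup>2) \<le> \<sigma>\<^sup>2" .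
qed

lemma F_growth_sq:
  assumes "v \<in> U"
  shows "(norm (F v))\<^sup>2 \<le> 2 * C\<^sup>2 * (norm v)\<^sup>2 + 2 * D\<^sup>2"
proof -
  have "norm (F v) \<le> C * norm v + D" using growth assms by (auto simp: linear_growth_on_def)
  then have "(norm (F v))\<^sup>2 \<le> (C * norm v + D)\<^sup>2" by (rule power_mono) simp
  also have "\<dots> \<le> 2 * (C * norm v)\<^sup>2 + 2 * D\<^sup>2"
    using norm_add_sq_le[of "C * norm v" D] by simp
  finally show ?thesis by (simp add: power_mult_distrib)
qed

lemma F_sq_integrable:
  assumes "sq_integrable P (h k)"
  shows "sq_integrable P (\<lambda>\<omega>. F (h k \<omega>))"
proof (rule sq_integrable_bound)
  show "integrable P (\<lambda>\<omega>. 2 * C\<^sup>2 * (norm (h k \<omega>))\<^sup>2 + 2 * D\<^sup>2)"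
    using sq_integrable_integrable[OF assms] by simp
qed (auto intro: F_growth_sq iter_in_U)

lemma G_decomp: "G k \<omega> = F (h k \<omega>) + noise_vec k \<omega>"
  by (simp add: noise_vec_def)

lemma iter_Suc:
  assumes "\<omega> \<in> space P"
  shows "u (Suc k) \<omega> = closest_point U (u k \<omega> - \<alpha> k *\<^sub>R G k \<omega>)"
    and "h (Suc k) \<omega> = closest_point U (u (Suc k) \<omega> - \<alpha> (Suc k) *\<^sub>R G k \<omega>)"
  using popov assms by (auto simp: stochastic_popov_def G_def)

text \<open>The start is deterministic, linear growth carries square integrability from
  \<open>h k\<close> to \<open>F (h k)\<close>, the noise is square integrable, and projections
  preserve the property. Hence every expectation below is that of an integrable function.\<close>

lemma iter_sq_integrable: "sq_integrable P (u k) \<and> sq_integrable P (h k)"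
proof (induction k)
  case 0
  have "sq_integrable P (u 0) \<longleftrightarrow> sq_integrable P (\<lambda>_. u\<^sub>0)"
    "sq_integrable P (h 0) \<longleftrightarrow> sq_integrable P (\<lambda>_. h\<^sub>0)"
    using popov by (auto intro!: sq_integrable_cong simp: stochastic_popov_def)
  then show ?case by (simp add: sq_integrable_const)
next
  case (Suc k)
  then have G: "sq_integrable P (G k)"
    using sq_integrable_add[OF F_sq_integrable noise_vec_sq_integrable, of k k]
    by (simp flip: G_decomp)
  have u: "sq_integrable P (u (Suc k))"
    using sq_integrable_closest_point[OF U U_nonempty sq_integrable_diff[OF _ sq_integrable_scaleR[OF G]]]
      Suc by (subst sq_integrable_cong[OF iter_Suc(1)]) auto
  have "sq_integrable P (h (Suc k))"
    using sq_integrable_closest_point[OF U U_nonempty sq_integrable_diff[OF u sq_integrable_scaleR[OF G]]]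
    by (subst sq_integrable_cong[OF iter_Suc(2)]) auto
  with u show ?case by blast
qed

lemma u_sq_integrable: "sq_integrable P (u k)"
  and h_sq_integrable: "sq_integrable P (h k)"
  and Fh_sq_integrable: "sq_integrable P (\<lambda>\<omega>. F (h k \<omega>))"
  using iter_sq_integrable F_sq_integrable by blast+

lemma G_sq_integrable: "sq_integrable P (G k)"
  using sq_integrable_add[OF Fh_sq_integrable noise_vec_sq_integrable, of k k]
  by (simp flip: G_decomp)

lemma sol_proj_sq_integrable: "sq_integrable P (sol_proj k)"
  using sq_integrable_closest_point[OF S(2) S_convex S(1) u_sq_integrable] unfolding sol_proj_def .

lemma sq_dist_integrable: "integrable P (sq_dist k)"
  using sq_integrable_integrable[OF sq_integrable_diff[OF u_sq_integrable sol_proj_sq_integrable]]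
  unfolding sq_dist_eq .

text \<open>The pair of iterates depends on earlier samples only, so the current sample can be
  averaged first with the pair frozen, and \<open>F\<close> is the mean of \<open>\<Phi>\<close>.
  The vector \<open>z\<close> may depend on \<open>u k\<close> as well, as needed for the projection
  of \<open>u k\<close> onto the solutions; a mean conditional on \<open>h k\<close> alone would not
  allow this.\<close>

lemma noise_orthogonal:
  assumes z[measurable]: "z \<in> borel \<Otimes>\<^sub>M borel \<rightarrow>\<^sub>M borel"
    and sq: "sq_integrable P (\<lambda>\<omega>. z (u k \<omega>, h k \<omega>))"
  shows "expectation (\<lambda>\<omega>. noise_vec k \<omega> \<bullet> z (u k \<omega>, h k \<omega>)) = 0"
proof -
  let ?p = "closest_point U"
  obtain f where [measurable]: "f \<in> PiM {..<k} (\<lambda>_. borel) \<rightarrow>\<^sub>M borel \<Otimes>\<^sub>M borel"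
    and f: "\<And>\<omega>. \<omega> \<in> space P \<Longrightarrow> (u k \<omega>, h k \<omega>) = f (\<lambda>i\<in>{..<k}. \<xi>s i \<omega>)"
    using iter_factor[of k] by blast
  \<comment> \<open>The library's \<^const>\<open>indep_var\<close> wants both variables of one type, so independence is used
    for the sample tuples rather than for \<open>(u\<^sub>k, h\<^sub>k)\<close> and \<open>\<xi>\<^sub>k\<close>.\<close>
  let ?A = "PiM {..<k} (\<lambda>_. borel :: (real^'d) measure)" and ?B = "PiM {k} (\<lambda>_. borel :: (real^'d) measure)"
  let ?past = "\<lambda>\<omega>. \<lambda>i\<in>{..<k}. \<xi>s i \<omega>" and ?now = "\<lambda>\<omega>. \<lambda>i\<in>{k}. \<xi>s i \<omega>"
  define g where "g = (\<lambda>w x. (\<Phi> (?p (snd w)) x - F (?p (snd w))) \<bullet> z w)"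
  have indep': "indep_var ?A ?past ?B ?now"
    by (rule indep_var_restrict[OF indep]) auto
  have [measurable]: "(\<lambda>x. x k) \<in> ?B \<rightarrow>\<^sub>M borel"
    by (rule measurable_component_singleton) simp
  have "(\<lambda>(w :: (real^'m) \<times> (real^'m), x :: real^'d). (snd w, x)) \<in>
      (borel \<Otimes>\<^sub>M borel) \<Otimes>\<^sub>M borel \<rightarrow>\<^sub>M borel \<Otimes>\<^sub>M borel" by measurable
  from measurable_compose[OF this \<Phi>_proj_meas]
  have [measurable]: "(\<lambda>(w :: (real^'m) \<times> (real^'m), x). \<Phi> (?p (snd w)) x) \<in>
      borel_measurable ((borel \<Otimes>\<^sub>M borel) \<Otimes>\<^sub>M borel)" by (simp add: case_prod_beta')
  have [measurable]: "case_prod g \<in> borel_measurable ((borel \<Otimes>\<^sub>M borel) \<Otimes>\<^sub>M borel)"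
    unfolding g_def by measurable
  have eq: "noise_vec k \<omega> \<bullet> z (u k \<omega>, h k \<omega>) = g (f (?past \<omega>)) (?now \<omega> k)" if "\<omega> \<in> space P" for \<omega>
    using that by (simp add: g_def noise_vec_def G_def closest_point_self iter_in_U flip: f)
  have int: "integrable P (\<lambda>\<omega>. g (f (?past \<omega>)) (?now \<omega> k))"
    using integrable_inner_sq_integrable[OF noise_vec_sq_integrable[of k] sq]
    by (subst Bochner_Integration.integrable_cong[OF refl eq[symmetric]])
  have "expectation (\<lambda>\<omega>. noise_vec k \<omega> \<bullet> z (u k \<omega>, h k \<omega>)) =
      expectation (\<lambda>\<omega>. g (f (?past \<omega>)) (?now \<omega> k))"
    by (rule Bochner_Integration.integral_cong) (auto simp: eq)
  also have "\<dots> = expectation (\<lambda>\<omega>. \<integral>x. g (f (?past \<omega>)) (x k) \<partial>distr P ?B ?now)"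
    using indep_var_expectation[OF indep', of "\<lambda>(a, x). g (f a) (x k)"] int by simp
  also have "(\<lambda>\<omega>. \<integral>x. g (f (?past \<omega>)) (x k) \<partial>distr P ?B ?now) = (\<lambda>_. 0)"
  proof
    fix \<omega>
    define w where "w = f (?past \<omega>)"
    let ?v = "?p (snd w)"
    \<comment> \<open>The projection lands in \<open>U\<close> whatever the past is, so the inner
      integral vanishes for every \<open>\<omega>\<close>, not just almost surely.\<close>
    have v: "?v \<in> U" using closest_point_in_set[OF U(1) U_nonempty] .
    note [measurable] = \<xi>_meas
    have [measurable]: "g w \<in> borel_measurable borel" unfolding g_def by measurable
    have "(\<integral>x. g w (x k) \<partial>distr P ?B ?now) = expectation (\<lambda>\<omega>'. g w (\<xi>s k \<omega>'))"
      by (subst integral_distr[of _ P ?B]) (auto intro!: measurable_compose[of "\<lambda>x. x k"])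
    also have "\<dots> = (\<integral>x. g w x \<partial>distr P borel (\<xi>s k))"
      by (rule integral_distr[symmetric]) measurable
    also have "\<dots> = expectation (\<lambda>\<omega>'. g w (\<xi> \<omega>'))"
      unfolding distr by (rule integral_distr) measurable
    also have "\<dots> = expectation (\<lambda>\<omega>'. \<Phi> ?v (\<xi> \<omega>') - F ?v) \<bullet> z w"
      unfolding g_def using \<Phi>_int[OF v] by simp
    also have "\<dots> = 0" using \<Phi>_int[OF v] F_eq[OF v] by (simp add: prob_space)
    finally show "(\<integral>x. g (f (?past \<omega>)) (x k) \<partial>distr P ?B ?now) = 0" by (simp add: w_def)
  qed
  finally show ?thesis by simp
qed

section \<open>Pathwise estimates for one step\<close>

lemma sharpness:
  assumes "\<omega> \<in> space P"
  shows "\<mu> * (infdist (h k \<omega>) (VI_solutions U F))\<^sup>2 \<le> F (h k \<omega>) \<bullet> (h k \<omega> - sol_proj k \<omega>)"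
  using sharp iter_in_U(2)[OF assms] sol_proj_in unfolding two_quasi_sharp_on_def by blast

lemma sol_proj_in_U: "sol_proj k \<omega> \<in> U"
  using sol_proj_in by (auto simp: VI_solutions_def)

text \<open>Sharpness controls the distance at \<open>h k\<close>, whereas the recursion runs over
  the distance at \<open>u k\<close>. The distance function is 1-Lipschitz, so the exchange costs
  only the gap between the two points.\<close>

lemma sq_dist_split:
  "sq_dist k \<omega> \<le> 2 * (infdist (h k \<omega>) (VI_solutions U F))\<^sup>2 + 2 * (norm (h k \<omega> - u k \<omega>))\<^sup>2"
proof -
  let ?i = "infdist (h k \<omega>) (VI_solutions U F)" and ?n = "norm (h k \<omega> - u k \<omega>)"
  have "infdist (u k \<omega>) (VI_solutions U F) \<le> ?i + ?n"
    using infdist_triangle[of "u k \<omega>" _ "h k \<omega>"] by (simp add: dist_norm norm_minus_commute)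
  then have "sq_dist k \<omega> \<le> (?i + ?n)\<^sup>2"
    unfolding sq_dist_def by (intro power_mono) (auto simp: infdist_nonneg)
  also have "\<dots> \<le> 2 * ?i\<^sup>2 + 2 * ?n\<^sup>2"
    using norm_add_sq_le[of ?i ?n] by simp
  finally show ?thesis .
qed

text \<open>Twice the sharpness gain at \<open>h k\<close> becomes a contraction of the distance at
  \<open>u k\<close>, up to a multiple of the squared gap between \<open>h k\<close> and
  \<open>u k\<close>. The negative last term of \<open>popov_step\<close> absorbs that
  multiple.\<close>

lemma sq_dist_step:
  assumes \<omega>: "\<omega> \<in> space P" and k: "k = Suc j" and a: "0 \<le> \<alpha> k" "\<alpha> k * \<mu> \<le> 1 / 2"
  shows "sq_dist (Suc k) \<omega> \<le> (1 - \<alpha> k * \<mu>) * sq_dist k \<omega>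
    - 2 * \<alpha> k * (noise_vec k \<omega> \<bullet> (h k \<omega> - sol_proj k \<omega>))
    + (\<alpha> k)\<^sup>2 * (2 * (norm (G k \<omega>))\<^sup>2 + 2 * (norm (G j \<omega>))\<^sup>2)"
proof -
  let ?y = "sol_proj k \<omega>" and ?i = "(infdist (h k \<omega>) (VI_solutions U F))\<^sup>2"
  let ?n = "(norm (h k \<omega> - u k \<omega>))\<^sup>2"
  have "sq_dist (Suc k) \<omega> \<le> (norm (u (Suc k) \<omega> - ?y))\<^sup>2"
    by (rule sq_dist_le[OF sol_proj_in])
  also have "\<dots> \<le> (norm (u k \<omega> - ?y))\<^sup>2 - 2 * \<alpha> k * (G k \<omega> \<bullet> (h k \<omega> - ?y))
      + (\<alpha> k)\<^sup>2 * (norm (G k \<omega> - G j \<omega>))\<^sup>2 - ?n"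
    \<comment> \<open>The point \<open>h k\<close> is the projection from \<open>u k\<close> along
      the previous sample \<open>G j\<close>, which is why \<open>k\<close> must be a
      successor.\<close>
    using popov_step[OF U sol_proj_in_U iter_Suc(1)[OF \<omega>]] iter_Suc(2)[OF \<omega>, of j] k by blast
  also have "\<dots> = sq_dist k \<omega> - 2 * \<alpha> k * (F (h k \<omega>) \<bullet> (h k \<omega> - ?y))
      - 2 * \<alpha> k * (noise_vec k \<omega> \<bullet> (h k \<omega> - ?y))
      + (\<alpha> k)\<^sup>2 * (norm (G k \<omega> - G j \<omega>))\<^sup>2 - ?n"
    unfolding sq_dist_eq G_decomp[of k] by (simp add: inner_add_left distrib_left)
  finally have "sq_dist (Suc k) \<omega> \<le> \<dots>" .
  moreover have "2 * \<alpha> k * (\<mu> * ?i) \<le> 2 * \<alpha> k * (F (h k \<omega>) \<bullet> (h k \<omega> - ?y))"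
    using a by (intro mult_left_mono sharpness[OF \<omega>]) auto
  moreover have "(\<alpha> k)\<^sup>2 * (norm (G k \<omega> - G j \<omega>))\<^sup>2
      \<le> (\<alpha> k)\<^sup>2 * (2 * (norm (G k \<omega>))\<^sup>2 + 2 * (norm (G j \<omega>))\<^sup>2)"
    by (intro mult_left_mono norm_diff_sq_le) simp
  moreover have "(\<alpha> k * \<mu>) * sq_dist k \<omega> \<le> (\<alpha> k * \<mu>) * (2 * ?i + 2 * ?n)"
    using a \<mu> by (intro mult_left_mono sq_dist_split) auto
  \<comment> \<open>The gap enters with factor \<open>2 * \<alpha> k * \<mu>\<close>, at most 1 by
    the stepsize condition, so it is cancelled by \<open>- ?n\<close>.\<close>
  moreover have "(\<alpha> k * \<mu>) * ?n \<le> 1 / 2 * ?n" using a by (intro mult_right_mono) auto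
  ultimately show ?thesis by (simp add: algebra_simps)
qed

text \<open>This is a projected step analysed around \<open>u k\<close>, free of the earlier sample
  \<open>G j\<close>. Since \<open>F\<close> is evaluated at \<open>h k\<close>, its inner product
  with \<open>u k - sol_proj k\<close> has no useful sign and is bounded in absolute terms; hence a
  factor above 1.\<close>

lemma sq_dist_crude_step:
  assumes \<omega>: "\<omega> \<in> space P"
  shows "sq_dist (Suc k) \<omega> \<le> 3 / 2 * sq_dist k \<omega>
    - 2 * \<alpha> k * (noise_vec k \<omega> \<bullet> (u k \<omega> - sol_proj k \<omega>))
    + (\<alpha> k)\<^sup>2 * (2 * (norm (F (h k \<omega>)))\<^sup>2 + (norm (G k \<omega>))\<^sup>2)"
proof -
  let ?y = "sol_proj k \<omega>" and ?f = "F (h k \<omega>)" and ?z = "u k \<omega> - sol_proj k \<omega>"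
  have "sq_dist (Suc k) \<omega> \<le> (norm (u (Suc k) \<omega> - ?y))\<^sup>2"
    by (rule sq_dist_le[OF sol_proj_in])
  also have "\<dots> \<le> (norm (u k \<omega> - \<alpha> k *\<^sub>R G k \<omega> - ?y))\<^sup>2"
    using projected_step[OF U sol_proj_in_U, of "u k \<omega> - \<alpha> k *\<^sub>R G k \<omega>" k \<omega>]
    unfolding iter_Suc(1)[OF \<omega>, of k] by (smt (verit) zero_le_power2)
  also have "\<dots> = (norm ?z)\<^sup>2 - 2 * \<alpha> k * (G k \<omega> \<bullet> ?z) + (\<alpha> k)\<^sup>2 * (norm (G k \<omega>))\<^sup>2"
    unfolding power2_norm_eq_inner
    by (simp add: power2_eq_square inner_simps inner_commute algebra_simps)
  also have "G k \<omega> \<bullet> ?z = ?f \<bullet> ?z + noise_vec k \<omega> \<bullet> ?z"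
    unfolding G_decomp by (simp add: inner_add_left)
  finally have "sq_dist (Suc k) \<omega> \<le> sq_dist k \<omega> - 2 * \<alpha> k * (?f \<bullet> ?z + noise_vec k \<omega> \<bullet> ?z)
      + (\<alpha> k)\<^sup>2 * (norm (G k \<omega>))\<^sup>2"
    unfolding sq_dist_eq[of k] .
  moreover have "- 2 * \<alpha> k * (?f \<bullet> ?z) \<le> sq_dist k \<omega> / 2 + (\<alpha> k)\<^sup>2 * (2 * (norm ?f)\<^sup>2)"
  proof -
    \<comment> \<open>Young's inequality: half of this square bounds the cross term by half of the
      squared distance, which makes the factor \<open>3 / 2\<close>.\<close>
    have "0 \<le> (norm (?z + (2 * \<alpha> k) *\<^sub>R ?f))\<^sup>2" by simp
    then show ?thesis
      unfolding sq_dist_eq power2_norm_eq_inner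
      by (simp add: power2_eq_square inner_add_left inner_add_right inner_commute algebra_simps
          add_divide_distrib diff_divide_distrib)
  qed
  ultimately show ?thesis by (simp add: algebra_simps)
qed

section \<open>Vanishing noise terms, second moments and one step in expectation\<close>

lemma proj_S_meas[measurable]: "closest_point (VI_solutions U F) \<in> borel_measurable borel"
  using borel_measurable_closest_point[OF S(2) S_convex S(1)] .

lemma noise_orthogonal_h: "expectation (\<lambda>\<omega>. noise_vec k \<omega> \<bullet> (h k \<omega> - sol_proj k \<omega>)) = 0"
  using noise_orthogonal[of "\<lambda>w. snd w - closest_point (VI_solutions U F) (fst w)" k]
    sq_integrable_diff[OF h_sq_integrable sol_proj_sq_integrable] by (simp add: sol_proj_def)

lemma noise_orthogonal_u: "expectation (\<lambda>\<omega>. noise_vec k \<omega> \<bullet> (u k \<omega> - sol_proj k \<omega>)) = 0"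
  using noise_orthogonal[of "\<lambda>w. fst w - closest_point (VI_solutions U F) (fst w)" k]
    sq_integrable_diff[OF u_sq_integrable sol_proj_sq_integrable] by (simp add: sol_proj_def)

lemma noise_orthogonal_F: "expectation (\<lambda>\<omega>. noise_vec k \<omega> \<bullet> F (h k \<omega>)) = 0"
proof -
  have eq: "F (closest_point U (h k \<omega>)) = F (h k \<omega>)" if "\<omega> \<in> space P" for \<omega>
    using that by (simp add: closest_point_self iter_in_U)
  have "expectation (\<lambda>\<omega>. noise_vec k \<omega> \<bullet> F (closest_point U (h k \<omega>))) = 0"
    using noise_orthogonal[of "\<lambda>w. F (closest_point U (snd w))" k] Fh_sq_integrable[of k]
      sq_integrable_cong[of P, OF eq] by simp
  then show ?thesis
    by (subst Bochner_Integration.integral_cong[OF refl]) (auto simp: eq)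
qed

lemma F_second_moment:
  assumes "expectation (\<lambda>\<omega>. (norm (h k \<omega>))\<^sup>2) \<le> M"
  shows "expectation (\<lambda>\<omega>. (norm (F (h k \<omega>)))\<^sup>2) \<le> 2 * C\<^sup>2 * M + 2 * D\<^sup>2"
proof -
  have "expectation (\<lambda>\<omega>. (norm (F (h k \<omega>)))\<^sup>2)
      \<le> expectation (\<lambda>\<omega>. 2 * C\<^sup>2 * (norm (h k \<omega>))\<^sup>2 + 2 * D\<^sup>2)"
    using sq_integrable_integrable[OF Fh_sq_integrable] sq_integrable_integrable[OF h_sq_integrable]
    by (intro integral_mono) (auto intro: F_growth_sq iter_in_U)
  also have "\<dots> = 2 * C\<^sup>2 * expectation (\<lambda>\<omega>. (norm (h k \<omega>))\<^sup>2) + 2 * D\<^sup>2"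
    using sq_integrable_integrable[OF h_sq_integrable] by (simp add: prob_space)
  also have "\<dots> \<le> 2 * C\<^sup>2 * M + 2 * D\<^sup>2"
    using assms by (intro add_right_mono mult_left_mono) auto
  finally show ?thesis .
qed

text \<open>The cross term of noise and \<open>F (h k)\<close> has mean zero, so the second moments
  add without the factor 2 of the pathwise inequality.\<close>

lemma G_second_moment:
  "expectation (\<lambda>\<omega>. (norm (G k \<omega>))\<^sup>2) \<le> expectation (\<lambda>\<omega>. (norm (F (h k \<omega>)))\<^sup>2) + \<sigma>\<^sup>2"
proof -
  have "(\<lambda>\<omega>. (norm (G k \<omega>))\<^sup>2) = (\<lambda>\<omega>. (norm (F (h k \<omega>)))\<^sup>2
      + 2 * (noise_vec k \<omega> \<bullet> F (h k \<omega>)) + (norm (noise_vec k \<omega>))\<^sup>2)"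
    by (simp add: G_decomp power2_norm_eq_inner inner_simps inner_commute algebra_simps)
  then have "expectation (\<lambda>\<omega>. (norm (G k \<omega>))\<^sup>2) = expectation (\<lambda>\<omega>. (norm (F (h k \<omega>)))\<^sup>2)
      + 2 * expectation (\<lambda>\<omega>. noise_vec k \<omega> \<bullet> F (h k \<omega>)) + expectation (\<lambda>\<omega>. (norm (noise_vec k \<omega>))\<^sup>2)"
    using sq_integrable_integrable[OF Fh_sq_integrable[of k]]
      integrable_inner_sq_integrable[OF noise_vec_sq_integrable[of k] Fh_sq_integrable[of k]]
      sq_integrable_integrable[OF noise_vec_sq_integrable[of k]]
    by simp
  then show ?thesis using noise_orthogonal_F noise_vec_second_moment[of k] by simp
qed

lemma expected_step:
  assumes k: "k = Suc j" and a: "0 \<le> \<alpha> k" "\<alpha> k * \<mu> \<le> 1 / 2"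
  shows "expectation (sq_dist (Suc k)) \<le> (1 - \<alpha> k * \<mu>) * expectation (sq_dist k)
    + (\<alpha> k)\<^sup>2 * (2 * expectation (\<lambda>\<omega>. (norm (G k \<omega>))\<^sup>2) + 2 * expectation (\<lambda>\<omega>. (norm (G j \<omega>))\<^sup>2))"
proof -
  note ints = sq_dist_integrable sq_integrable_integrable[OF G_sq_integrable]
    integrable_inner_sq_integrable[OF noise_vec_sq_integrable
      sq_integrable_diff[OF h_sq_integrable sol_proj_sq_integrable]]
  have "expectation (sq_dist (Suc k)) \<le> expectation (\<lambda>\<omega>. (1 - \<alpha> k * \<mu>) * sq_dist k \<omega>
      - 2 * \<alpha> k * (noise_vec k \<omega> \<bullet> (h k \<omega> - sol_proj k \<omega>))
      + (\<alpha> k)\<^sup>2 * (2 * (norm (G k \<omega>))\<^sup>2 + 2 * (norm (G j \<omega>))\<^sup>2))"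
    using sq_dist_step[OF _ k a] ints by (intro integral_mono) auto
  also have "\<dots> = (1 - \<alpha> k * \<mu>) * expectation (sq_dist k)
      - 2 * \<alpha> k * expectation (\<lambda>\<omega>. noise_vec k \<omega> \<bullet> (h k \<omega> - sol_proj k \<omega>))
      + (\<alpha> k)\<^sup>2 * (2 * expectation (\<lambda>\<omega>. (norm (G k \<omega>))\<^sup>2) + 2 * expectation (\<lambda>\<omega>. (norm (G j \<omega>))\<^sup>2))"
    using ints by simp
  finally show ?thesis by (simp add: noise_orthogonal_h)
qed

lemma expected_crude_step:
  "expectation (sq_dist (Suc k)) \<le> 3 / 2 * expectation (sq_dist k)
    + (\<alpha> k)\<^sup>2 * (2 * expectation (\<lambda>\<omega>. (norm (F (h k \<omega>)))\<^sup>2) + expectation (\<lambda>\<omega>. (norm (G k \<omega>))\<^sup>2))"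
proof -
  note ints = sq_dist_integrable sq_integrable_integrable[OF G_sq_integrable]
    sq_integrable_integrable[OF Fh_sq_integrable]
    integrable_inner_sq_integrable[OF noise_vec_sq_integrable
      sq_integrable_diff[OF u_sq_integrable sol_proj_sq_integrable]]
  have "expectation (sq_dist (Suc k)) \<le> expectation (\<lambda>\<omega>. 3 / 2 * sq_dist k \<omega>
      - 2 * \<alpha> k * (noise_vec k \<omega> \<bullet> (u k \<omega> - sol_proj k \<omega>))
      + (\<alpha> k)\<^sup>2 * (2 * (norm (F (h k \<omega>)))\<^sup>2 + (norm (G k \<omega>))\<^sup>2))"
    using sq_dist_crude_step ints by (intro integral_mono) auto
  also have "\<dots> = 3 / 2 * expectation (sq_dist k)
      - 2 * \<alpha> k * expectation (\<lambda>\<omega>. noise_vec k \<omega> \<bullet> (u k \<omega> - sol_proj k \<omega>))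
      + (\<alpha> k)\<^sup>2 * (2 * expectation (\<lambda>\<omega>. (norm (F (h k \<omega>)))\<^sup>2) + expectation (\<lambda>\<omega>. (norm (G k \<omega>))\<^sup>2))"
    using ints by simp
  finally show ?thesis by (simp add: noise_orthogonal_u)
qed

end

subsection \<open>The convergence rate\<close>

text \<open>Independent samples with the law of \<open>\<xi>\<close> encode the fresh draw at each
  iteration. Integrability is part of the conclusion because a Bochner integral is 0 on
  nonintegrable functions. The hypothesis on \<open>M\<close> is likewise a genuine moment bound, as
  the iterates turn out to be square integrable.\<close>

theorem theorem3p5:
  fixes P :: "'w measure"
    and U :: "(real^'m) set"
    and F :: "real^'m \<Rightarrow> real^'m"
    and \<Phi> :: "real^'m \<Rightarrow> real^'d \<Rightarrow> real^'m"
    and \<xi> :: "'w \<Rightarrow> real^'d"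
    and \<xi>s :: "nat \<Rightarrow> 'w \<Rightarrow> real^'d"
    and u\<^sub>0 h\<^sub>0 :: "real^'m"
    and u h :: "nat \<Rightarrow> 'w \<Rightarrow> real^'m"
    and \<alpha> :: "nat \<Rightarrow> real"
    and \<sigma> C D \<mu> M :: real
    and K :: nat
  assumes "prob_space P"
    and "U \<noteq> {}" "closed U" "convex U"
    and "case_prod \<Phi> \<in> borel_measurable (restrict_space borel U \<Otimes>\<^sub>M borel)"
    and "\<xi> \<in> borel_measurable P"
    and "\<And>v. v \<in> U \<Longrightarrow> integrable P (\<lambda>\<omega>. \<Phi> v (\<xi> \<omega>))"
    and "\<And>v. v \<in> U \<Longrightarrow> F v = (\<integral>\<omega>. \<Phi> v (\<xi> \<omega>) \<partial>P)"
    and "VI_solutions U F \<noteq> {}" "closed (VI_solutions U F)"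
    and "prob_space.indep_vars P (\<lambda>_. borel) \<xi>s UNIV"
    and "\<And>k. distr P borel (\<xi>s k) = distr P borel \<xi>"
    and "u\<^sub>0 \<in> U" "h\<^sub>0 \<in> U"
    and "stochastic_popov (space P) U \<Phi> \<alpha> \<xi>s u\<^sub>0 h\<^sub>0 u h"
    and "\<sigma> > 0"
    and "\<And>k. unbiased_bounded_noise P (h k) (\<lambda>\<omega>. \<Phi> (h k \<omega>) (\<xi>s k \<omega>) - F (h k \<omega>)) \<sigma>"
    and "C \<ge> 0" "D \<ge> 0" "linear_growth_on U F C D"
    and "\<mu> > 0" "two_quasi_sharp_on U (VI_solutions U F) F \<mu>"
    and "\<And>k. \<alpha> k = 2 / (\<mu> * (3 + real k))"
    and "M > 0" "\<And>k. k \<ge> 1 \<Longrightarrow> (\<integral>\<omega>. (norm (h k \<omega>))\<^sup>2 \<partial>P) \<le> M"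
    and "K \<ge> 2"
  shows "integrable P (\<lambda>\<omega>. (infdist (u 1 \<omega>) (VI_solutions U F))\<^sup>2)
    \<and> integrable P (\<lambda>\<omega>. (infdist (u (K + 1) \<omega>) (VI_solutions U F))\<^sup>2)
    \<and> (\<integral>\<omega>. (infdist (u (K + 1) \<omega>) (VI_solutions U F))\<^sup>2 \<partial>P)
        \<le> 18 / (real K - 1)\<^sup>2 * (\<integral>\<omega>. (infdist (u 1 \<omega>) (VI_solutions U F))\<^sup>2 \<partial>P)
          + 24 * (4 * C\<^sup>2 * M + \<sigma>\<^sup>2 + 2 * D\<^sup>2) / (\<mu>\<^sup>2 * (real K - 1))"
proof -
  interpret popov_vi P U F \<Phi> \<xi> \<xi>s u\<^sub>0 h\<^sub>0 u h \<alpha> \<sigma> C D \<mu>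
    by (rule popov_vi.intro[OF assms(1)], unfold_locales) (use assms in auto)
  let ?d = "\<lambda>k. expectation (sq_dist k)"
  define A where "A = 2 * C\<^sup>2 * M + 2 * D\<^sup>2"
  note \<alpha> = assms(23)
  have A: "0 \<le> A" using \<open>M > 0\<close> by (simp add: A_def)
  have F2: "expectation (\<lambda>\<omega>. (norm (F (h k \<omega>)))\<^sup>2) \<le> A" if "k \<ge> 1" for k
    using F_second_moment[OF assms(25)[OF that]] by (simp add: A_def)
  have G2: "expectation (\<lambda>\<omega>. (norm (G k \<omega>))\<^sup>2) \<le> A + \<sigma>\<^sup>2" if "k \<ge> 1" for k
    using F2[OF that] G_second_moment[of k] by linarith
  \<comment> \<open>The bound \<open>M\<close> starts at index 1, and the crude step from
    \<open>u 1\<close> involves only \<open>h 1\<close>.\<close>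
  have first: "?d 2 \<le> 3 / 2 * ?d 1 + (\<alpha> 1)\<^sup>2 * (3 * A + \<sigma>\<^sup>2)"
  proof -
    have "?d 2 \<le> 3 / 2 * ?d 1 + (\<alpha> 1)\<^sup>2 *
        (2 * expectation (\<lambda>\<omega>. (norm (F (h 1 \<omega>)))\<^sup>2) + expectation (\<lambda>\<omega>. (norm (G 1 \<omega>))\<^sup>2))"
      using expected_crude_step[of 1] by (simp add: numeral_2_eq_2)
    also have "\<dots> \<le> 3 / 2 * ?d 1 + (\<alpha> 1)\<^sup>2 * (3 * A + \<sigma>\<^sup>2)"
      using F2[of 1] G2[of 1] by (intro add_left_mono mult_left_mono) auto
    finally show ?thesis .
  qed
  have step: "?d (Suc k) \<le> (1 - \<alpha> k * \<mu>) * ?d k + (\<alpha> k)\<^sup>2 * (4 * A + 4 * \<sigma>\<^sup>2)" if "k \<ge> 2" for k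
  proof -
    from that have "k \<noteq> 0" by simp
    then obtain j where k: "k = Suc j" by (cases k) auto
    \<comment> \<open>From \<open>k \<ge> 2\<close> on, the moment bound covers both samples
      \<open>G k\<close> and \<open>G j\<close>.\<close>
    with that have j: "j \<ge> 1" by simp
    have a: "0 \<le> \<alpha> k" "\<alpha> k * \<mu> \<le> 1 / 2"
      using \<open>\<mu> > 0\<close> that by (simp_all add: \<alpha> divide_le_eq)
    have "?d (Suc k) \<le> (1 - \<alpha> k * \<mu>) * ?d k + (\<alpha> k)\<^sup>2 *
        (2 * expectation (\<lambda>\<omega>. (norm (G k \<omega>))\<^sup>2) + 2 * expectation (\<lambda>\<omega>. (norm (G j \<omega>))\<^sup>2))"
      using expected_step[OF k a] .
    also have "\<dots> \<le> (1 - \<alpha> k * \<mu>) * ?d k + (\<alpha> k)\<^sup>2 * (4 * A + 4 * \<sigma>\<^sup>2)"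
      using G2[of k] G2[OF j] that by (intro add_left_mono mult_left_mono) auto
    finally show ?thesis .
  qed
  have "0 \<le> ?d 1" by (simp add: sq_dist_def)
  from popov_recursion_bound[OF \<open>\<mu> > 0\<close> \<alpha> this A zero_le_power2 first step \<open>K \<ge> 2\<close>]
  have "?d (K + 1) \<le> 18 / (real K - 1)\<^sup>2 * ?d 1 + 24 * (A + \<sigma>\<^sup>2) / (\<mu>\<^sup>2 * (real K - 1))"
    by simp
  \<comment> \<open>\<open>A\<close> contains \<open>2 * C\<^sup>2 * M\<close>, so the stated
    constant holds with room to spare.\<close>
  also have "24 * (A + \<sigma>\<^sup>2) / (\<mu>\<^sup>2 * (real K - 1))
      \<le> 24 * (4 * C\<^sup>2 * M + \<sigma>\<^sup>2 + 2 * D\<^sup>2) / (\<mu>\<^sup>2 * (real K - 1))"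
    using \<open>M > 0\<close> \<open>K \<ge> 2\<close> by (intro divide_right_mono mult_left_mono) (auto simp: A_def)
  finally show ?thesis
    using sq_dist_integrable[of 1] sq_dist_integrable[of "K + 1"] by (simp add: sq_dist_def[abs_def])
qed

end
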